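(* Let $\zeta(z)=\sum_{n=1}^{\infty}\frac{1}{n^{z}}$ with $\Re(z)>1$. Then the limit of the Riemann zeta function is given, for sufficiently large $n$, as $$\zeta(z)=1+\frac12\sum_{r=2}^{n}\coth\left(\frac{z\log r}{2}\right)-\frac{l}{2}=\frac{2-l}{2}+\frac12\sum_{r=2}^{n}\coth\left(\frac{z\log r}{2}\right),$$ where $l$ is the number of terms in the sum $\sum_{r=2}^{n}\coth\left(\frac{z\log r}{2}\right)$, and where the summation index $r$ satisfies $r\neq 2^{k},3^{k},5^{k},6^{k},7^{k},10^{k},11^{k},12^{k},\cdots$ with $k=2,3,4,\cdots$.
   Context: Here $z$ is a complex number and $\zeta$ is the Riemann zeta function. The sums run over the integers $r$ from $2$ to $n$ with the excluded values omitted; the excluded values are the perfect powers $a^{k}$ with integers $a\ge 2$, $k\ge 2$, so $r$ runs through $2,3,5,6,7,10,11,12,\dots$ up to $n$. $\log$ is the natural logarithm and $\coth$ is the hyperbolic cotangent, $\coth(w)=\frac{e^{w}+e^{-w}}{e^{w}-e^{-w}}$. *)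

theory Defs
  imports "HOL-Analysis.Analysis"
begin

(* Meaningful for Re z > 1, where the Dirichlet series converges.
   The summation variable is shifted: term number n is 1 / (n + 1)^z. *)
definition zeta :: "complex \<Rightarrow> complex" where
  "zeta z = (\<Sum>n. 1 / of_nat (Suc n) powr z)"

definition coth :: "complex \<Rightarrow> complex" where
  "coth w = (exp w + exp (- w)) / (exp w - exp (- w))"

definition perfect_power :: "nat \<Rightarrow> bool" where
  "perfect_power r \<longleftrightarrow> (\<exists>a k. a \<ge> 2 \<and> k \<ge> 2 \<and> r = a ^ k)"

(* 2, 3, 5, 6, 7, 10, 11, 12, ... up to n *)
definition indices :: "nat \<Rightarrow> nat set" where
  "indices n = {r \<in> {2..n}. \<not> perfect_power r}"

definition coth_sum :: "complex \<Rightarrow> nat \<Rightarrow> complex" where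
  "coth_sum z n = (\<Sum>r\<in>indices n. coth (z * complex_of_real (ln (real r)) / 2))"

definition num_terms :: "nat \<Rightarrow> nat" where
  "num_terms n = card (indices n)"

end

theory Submission
  imports Defs
begin

text \<open>
  Expanding the hyperbolic cotangent at \<open>w = z ln r / 2\<close> as a geometric series gives
  \<open>(coth w - 1) / 2 = (\<Sum>k\<ge>1. (r\<^sup>k) powr (- z))\<close>, so each index \<open>r\<close> accounts for the part of the
  Dirichlet series of \<open>zeta\<close> that lives on the powers \<open>r, r\<^sup>2, r\<^sup>3, \<dots>\<close>.  Every integer \<open>m \<ge> 2\<close> is
  a power \<open>r\<^sup>k\<close> of exactly one \<open>r\<close> that is not itself a perfect power, with exactly one
  \<open>k \<ge> 1\<close> (\<open>bij_betw_primitive_powers\<close>), so these parts partition the whole series except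
  its first term \<open>1\<close>.  For \<open>Re z > 1\<close> the Dirichlet series converges absolutely, and summing it
  fibre by fibre over \<open>r\<close> yields \<open>zeta z - 1\<close> (\<open>has_sum_primitive_indices\<close>).  Subtracting
  \<open>1 / 2\<close> once per index is what produces the term with the number of indices.
\<close>

section \<open>Unique representation as a power of a primitive base\<close>

definition primitive_bases :: "nat set" where
  "primitive_bases = {r. r \<ge> 2 \<and> \<not> perfect_power r}"

text \<open>
  By Bezout, \<open>a x = b y + 1\<close>, so \<open>(s\<^sup>x)\<^sup>b = r\<^bsup>a x\<^esup> = (r\<^sup>y)\<^sup>b r\<close>: the number \<open>r\<close> is a quotient of two
  \<open>b\<close>-th powers, and an integral such quotient is itself a \<open>b\<close>-th power.
\<close>

lemma coprime_exponents_imp_power: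
  fixes r s a b :: nat
  assumes eq: "r ^ a = s ^ b" and "coprime a b" "a > 0" "b > 0" "r > 0"
  shows "\<exists>t. r = t ^ b"
proof -
  obtain x y where xy: "a * x = b * y + 1"
    using bezout_nat[of a b] assms by auto
  have "(s ^ x) ^ b = (s ^ b) ^ x"
    by (simp add: power_mult [symmetric] mult.commute)
  also have "\<dots> = r ^ (b * y + 1)"
    unfolding eq [symmetric] xy [symmetric] by (simp add: power_mult)
  also have "\<dots> = (r ^ y) ^ b * r"
    by (simp add: power_mult [symmetric] mult.commute)
  finally have *: "(s ^ x) ^ b = (r ^ y) ^ b * r" .
  then have "(r ^ y) ^ b dvd (s ^ x) ^ b"
    by simp
  then obtain t where "s ^ x = r ^ y * t"
    using \<open>b > 0\<close> by (auto elim: dvdE)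
  with * have "(r ^ y) ^ b * t ^ b = (r ^ y) ^ b * r"
    by (simp add: power_mult_distrib)
  then show ?thesis
    using \<open>r > 0\<close> by auto
qed

lemma primitive_base_power_exponent:
  assumes "r \<in> primitive_bases" "r = t ^ b"
  shows "b = 1"
proof (rule ccontr)
  assume "b \<noteq> 1"
  have "r \<ge> 2" "\<not> perfect_power r"
    using assms by (auto simp: primitive_bases_def)
  have "b \<noteq> 0"
    using \<open>r \<ge> 2\<close> assms(2) by (cases b) auto
  moreover have "t \<ge> 2"
  proof (rule ccontr)
    assume "\<not> t \<ge> 2"
    then have "t = 0 \<or> t = 1" by auto
    then show False
      using \<open>r \<ge> 2\<close> assms(2) \<open>b \<noteq> 0\<close> by (auto simp: power_0_left)
  qed
  ultimately have "perfect_power r"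
    using \<open>b \<noteq> 1\<close> assms(2) unfolding perfect_power_def
    by (intro exI[of _ t] exI[of _ b]) auto
  with \<open>\<not> perfect_power r\<close> show False ..
qed

text \<open>
  After division of the exponents by their gcd, each base is a power with the other exponent,
  so primitivity forces both reduced exponents to be \<open>1\<close>.
\<close>

lemma primitive_power_unique:
  assumes r: "r \<in> primitive_bases" and s: "s \<in> primitive_bases"
    and pos: "a > 0" "b > 0" and eq: "r ^ a = s ^ b"
  shows "r = s \<and> a = b"
proof -
  have r0: "r > 0" "s > 0"
    using r s by (auto simp: primitive_bases_def)
  define g where "g = gcd a b"
  have "g > 0"
    using pos by (simp add: g_def)
  obtain a' b' where ab: "a = a' * g" "b = b' * g" "coprime a' b'"
    using gcd_coprime_exists[of a b] \<open>g > 0\<close> unfolding g_def by auto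
  have pos': "a' > 0" "b' > 0"
    using pos ab by (auto intro: gr0I)
  have "(r ^ a') ^ g = (s ^ b') ^ g"
    using eq ab by (simp add: power_mult)
  then have eq': "r ^ a' = s ^ b'"
    using \<open>g > 0\<close> by (simp add: power_eq_iff_eq_base)
  have "b' = 1"
    using coprime_exponents_imp_power[OF eq' ab(3) pos' r0(1)]
      primitive_base_power_exponent[OF r] by auto
  moreover have "a' = 1"
    using coprime_exponents_imp_power[OF eq'[symmetric] _ pos'(2,1) r0(2)] ab(3)
      primitive_base_power_exponent[OF s] by (auto simp: coprime_commute)
  ultimately show ?thesis
    using eq' ab by simp
qed

text \<open>Taking roots strictly decreases the number, so it ends at a primitive base.\<close>

lemma primitive_power_exists:
  assumes "m \<ge> 2"
  shows "\<exists>r\<in>primitive_bases. \<exists>k\<ge>1. m = r ^ k"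
  using assms
proof (induction m rule: less_induct)
  case (less m)
  show ?case
  proof (cases "perfect_power m")
    case False
    then have "m \<in> primitive_bases"
      using less.prems by (simp add: primitive_bases_def)
    then show ?thesis
      by (intro bexI[of _ m] exI[of _ 1]) auto
  next
    case True
    then obtain a k where ak: "a \<ge> 2" "k \<ge> 2" "m = a ^ k"
      by (auto simp: perfect_power_def)
    then have "a ^ 1 < a ^ k"
      by (intro power_strict_increasing) auto
    then obtain r j where "r \<in> primitive_bases" "j \<ge> 1" "a = r ^ j"
      using less.IH[of a] ak by auto
    then show ?thesis
      using ak by (intro bexI[of _ r] exI[of _ "j * k"]) (auto simp: power_mult)
  qed
qed

lemma bij_betw_primitive_powers:
  "bij_betw (\<lambda>(r, k). r ^ k) (primitive_bases \<times> {1::nat..}) {2..}"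
proof (rule bij_betw_imageI)
  show "inj_on (\<lambda>(r, k). r ^ k) (primitive_bases \<times> {1::nat..})"
  proof (rule inj_onI)
    fix p q :: "nat \<times> nat"
    assume "p \<in> primitive_bases \<times> {1..}" "q \<in> primitive_bases \<times> {1..}"
      and "(case p of (r, k) \<Rightarrow> r ^ k) = (case q of (r, k) \<Rightarrow> r ^ k)"
    then show "p = q"
      using primitive_power_unique[of "fst p" "fst q" "snd p" "snd q"]
      by (cases p; cases q) auto
  qed
  have "r ^ k \<ge> 2" if "r \<in> primitive_bases" "k \<ge> 1" for r k :: nat
  proof -
    have "r \<ge> 2"
      using that by (simp add: primitive_bases_def)
    moreover have "r ^ 1 \<le> r ^ k"
      using that \<open>r \<ge> 2\<close> by (intro power_increasing) auto
    ultimately show ?thesis by simp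
  qed
  moreover have "m \<in> (\<lambda>(r, k). r ^ k) ` (primitive_bases \<times> {1::nat..})"
    if m: "m \<ge> 2" for m
  proof -
    obtain r k where "r \<in> primitive_bases" "k \<ge> 1" "m = r ^ k"
      using primitive_power_exists[OF m] by auto
    then show ?thesis
      by (auto intro: image_eqI[of _ _ "(r, k)"])
  qed
  ultimately show "(\<lambda>(r, k). r ^ k) ` (primitive_bases \<times> {1::nat..}) = {2..}"
    by auto
qed

section \<open>Grouping the Dirichlet series by primitive base\<close>

lemma has_sum_zeta:
  assumes "Re z > 1"
  shows "((\<lambda>m. 1 / of_nat m powr z) has_sum zeta z) UNIV"
proof -
  let ?f = "\<lambda>m. 1 / (of_nat m :: complex) powr z"
  have "norm (?f m) = real m powr (- Re z)" for m
    by (simp add: norm_divide norm_powr_real_powr powr_minus_divide)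
  then have summable: "summable (\<lambda>m. norm (?f m))"
    using assms summable_real_powr_iff[of "- Re z"] by simp
  then have "summable (\<lambda>n. ?f (Suc n))"
    by (subst summable_Suc_iff) (rule summable_norm_cancel)
  then have "(\<lambda>n. ?f (Suc n)) sums zeta z"
    unfolding zeta_def by (rule summable_sums)
  \<comment> \<open>The extra term at \<open>0\<close> vanishes because \<open>0 powr z = 0\<close> and \<open>1 / 0 = 0\<close>.\<close>
  then have "?f sums zeta z"
    by (rule sums_Suc_imp [rotated]) simp
  with summable show ?thesis
    by (rule norm_summable_imp_has_sum)
qed

lemma has_sum_zeta_minus_one:
  assumes "Re z > 1"
  shows "((\<lambda>m. 1 / of_nat m powr z) has_sum (zeta z - 1)) {2..}"
proof -
  let ?f = "\<lambda>m. 1 / (of_nat m :: complex) powr z"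
  have "(?f has_sum 1) {0, 1}"
    by (rule has_sum_finiteI) auto
  with has_sum_zeta[OF assms] have "(?f has_sum (zeta z - 1)) (UNIV - {0, 1})"
    by (rule has_sum_Diff) auto
  moreover have "UNIV - {0, 1} = {2::nat..}"
    by auto
  ultimately show ?thesis by simp
qed

text \<open>
  With \<open>w = z ln r / 2\<close> the number \<open>q\<close> is \<open>exp (- 2 w)\<close>, and the right-hand side is the value of
  the geometric series \<open>q + q\<^sup>2 + q\<^sup>3 + \<dots>\<close>.
\<close>

lemma half_coth_minus_half:
  assumes "Re z > 0" "r \<ge> 2"
  defines "q \<equiv> 1 / of_nat r powr z"
  shows "1 / 2 * coth (z * complex_of_real (ln (real r)) / 2) - 1 / 2 = q / (1 - q)"
    and "norm q < 1"
proof -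
  define w where "w = z * complex_of_real (ln (real r)) / 2"
  have "of_nat r powr z = exp (2 * w)"
    using \<open>r \<ge> 2\<close> Ln_of_nat[of r] by (simp add: powr_def w_def)
  also have "\<dots> = exp w * exp w"
    by (simp add: exp_add [symmetric])
  finally have q: "q = exp (- w) / exp w"
    by (simp add: q_def exp_minus divide_inverse)
  have "norm q = 1 / real r powr Re z"
    by (simp add: q_def norm_divide norm_powr_real_powr)
  moreover have "real r powr Re z > 1"
    using assms by simp
  ultimately show "norm q < 1"
    using \<open>r \<ge> 2\<close> by (simp add: divide_less_eq_1)
  then have "q \<noteq> 1"
    by auto
  then have "exp w - exp (- w) \<noteq> 0"
    by (auto simp: q)
  moreover have "1 / 2 * ((a + b) / (a - b)) - 1 / 2 = b / (a - b)" if "a - b \<noteq> 0" for a b :: complex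
    using that by (simp add: divide_simps)
  ultimately have "1 / 2 * coth w - 1 / 2 = exp (- w) / (exp w - exp (- w))"
    unfolding coth_def by blast
  also have "\<dots> = q / (1 - q)"
    using \<open>exp w - exp (- w) \<noteq> 0\<close> by (simp add: q divide_simps)
  finally show "1 / 2 * coth (z * complex_of_real (ln (real r)) / 2) - 1 / 2 = q / (1 - q)"
    unfolding w_def .
qed

lemma powr_of_nat_power:
  assumes "r > 0"
  shows "1 / of_nat (r ^ k) powr z = (1 / (of_nat r :: complex) powr z) ^ k"
  using assms Ln_of_nat[of r] Ln_of_nat[of "r ^ k"]
  by (simp add: powr_def ln_realpow exp_of_nat_mult [symmetric] power_one_over algebra_simps)

text \<open>
  The bijection turns \<open>zeta z - 1\<close> into a double sum over bases and exponents, whose inner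
  sums are geometric series.
\<close>

lemma has_sum_primitive_indices:
  assumes "Re z > 1"
  shows "((\<lambda>r. 1 / 2 * coth (z * complex_of_real (ln (real r)) / 2) - 1 / 2)
           has_sum (zeta z - 1)) primitive_bases"
proof (rule has_sum_SigmaD)
  show "((\<lambda>p. 1 / of_nat (case p of (r, k) \<Rightarrow> r ^ k) powr z) has_sum (zeta z - 1))
          (primitive_bases \<times> {1..})"
    using has_sum_reindex_bij_betw[OF bij_betw_primitive_powers,
        of "\<lambda>m. 1 / of_nat m powr z" "zeta z - 1"] has_sum_zeta_minus_one[OF assms]
    by simp
next
  fix r assume "r \<in> primitive_bases"
  then have "r \<ge> 2"
    by (simp add: primitive_bases_def)
  then have *: "1 / of_nat (r ^ k) powr z = (1 / (of_nat r :: complex) powr z) ^ k" for k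
    by (intro powr_of_nat_power) auto
  show "((\<lambda>k. 1 / of_nat (case (r, k) of (r, k) \<Rightarrow> r ^ k) powr z) has_sum
          (1 / 2 * coth (z * complex_of_real (ln (real r)) / 2) - 1 / 2)) {1..}"
    using has_sum_geometric_from_1[of "1 / of_nat r powr z"]
      half_coth_minus_half[of z r] assms \<open>r \<ge> 2\<close>
    by (simp add: * del: of_nat_power)
qed

lemma indices_eq_primitive_bases: "indices n = primitive_bases \<inter> {..n}"
  by (auto simp: indices_def primitive_bases_def)

theorem theorem1:
  fixes z :: complex
  assumes "Re z > 1"
  shows "((\<lambda>n. 1 + 1 / 2 * coth_sum z n - of_nat (num_terms n) / 2) \<longlonglongrightarrow> zeta z)
    \<and> ((\<lambda>n. (2 - of_nat (num_terms n)) / 2 + 1 / 2 * coth_sum z n) \<longlonglongrightarrow> zeta z)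
    \<and> (\<forall>n. 1 + 1 / 2 * coth_sum z n - of_nat (num_terms n) / 2
          = (2 - of_nat (num_terms n)) / 2 + 1 / 2 * coth_sum z n)"
proof -
  let ?h = "\<lambda>r. 1 / 2 * coth (z * complex_of_real (ln (real r)) / 2) - 1 / 2"
  let ?g = "\<lambda>r. if r \<in> primitive_bases then ?h r else 0"
  have "(?g has_sum (zeta z - 1)) UNIV"
    using has_sum_primitive_indices[OF assms]
    by (subst has_sum_cong_neutral[where T = primitive_bases and g = ?h]) auto
  then have "?g sums (zeta z - 1)"
    by (rule has_sum_imp_sums)
  then have "(\<lambda>n. 1 + (\<Sum>r\<le>n. ?g r)) \<longlonglongrightarrow> 1 + (zeta z - 1)"
    by (intro tendsto_intros) (simp add: sums_def_le)
  moreover have "1 + (\<Sum>r\<le>n. ?g r) = 1 + 1 / 2 * coth_sum z n - of_nat (num_terms n) / 2" for n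
  proof -
    have "(\<Sum>r\<le>n. ?g r) = (\<Sum>r\<in>indices n. ?h r)"
      unfolding indices_eq_primitive_bases
      by (intro sum.mono_neutral_cong_right) auto
    also have "\<dots> = 1 / 2 * coth_sum z n - of_nat (num_terms n) / 2"
      by (simp add: sum_subtractf coth_sum_def num_terms_def sum_divide_distrib)
    finally show ?thesis
      by (simp only: add_diff_eq)
  qed
  ultimately have lim: "(\<lambda>n. 1 + 1 / 2 * coth_sum z n - of_nat (num_terms n) / 2) \<longlonglongrightarrow> zeta z"
    by simp
  have eq: "1 + 1 / 2 * coth_sum z n - of_nat (num_terms n) / 2
          = (2 - of_nat (num_terms n)) / 2 + 1 / 2 * coth_sum z n" for n
    by (simp add: diff_divide_distrib)
  show ?thesis
    using lim by (simp only: eq simp_thms)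
qed

end
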